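(* Let $G=(V,E)$ be a connected graph with $\lambda_2(A_G)=2$ and $\Delta_G\le 14$. Then $m_2(A_G)\le 80$.
   Context: Graphs are finite and simple. $A_G$ denotes the adjacency matrix of $G$, with eigenvalues listed with multiplicity as $\lambda_1(A_G)\ge\lambda_2(A_G)\ge\cdots\ge\lambda_n(A_G)$, $n=|V|$. $\Delta_G$ is the maximum degree of $G$. $m_\lambda(A_G)$ is the multiplicity of $\lambda$ as an eigenvalue of $A_G$; thus $m_2(A_G)$ is the multiplicity of the eigenvalue $2$. *)

theory Defs
  imports
    "HOL-Computational_Algebra.Computational_Algebra"
    "Graph_Theory.Digraph"
    "Graph_Theory.Digraph_Component"
    "Jordan_Normal_Form.Char_Poly"
begin

text \<open>
  A finite simple graph is an instance of the locale \<^locale>\<open>graph\<close> of the AFP entry Graph_Theory: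
  a finite symmetric digraph without loops and multiple arcs, in which every edge is represented
  by its two opposite arcs. The degree of a vertex is therefore its out-degree.
\<close>

definition max_degree :: "('a, 'b) pre_digraph \<Rightarrow> nat" where
  "max_degree G = Max (out_degree G ` verts G)"

text \<open>
  The list \<open>vs\<close> is meant to enumerate the vertices of \<open>G\<close> without repetition and fixes which
  row and column belongs to which vertex.
\<close>

definition adjacency_matrix :: "('a, 'b) pre_digraph \<Rightarrow> 'a list \<Rightarrow> real mat" where
  "adjacency_matrix G vs =
     mat (length vs) (length vs) (\<lambda>(i, j). if vs ! i \<rightarrow>\<^bsub>G\<^esub> vs ! j then 1 else 0)"

text \<open>
  Eigenvalues are counted with their multiplicity as roots of the characteristic polynomial.
  Only real eigenvalues are listed; for a symmetric real matrix these are all the eigenvalues,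
  and the algebraic and geometric multiplicities agree.
\<close>

definition eigenvalue_multiset :: "real mat \<Rightarrow> real multiset" where
  "eigenvalue_multiset A = proots (char_poly A)"

definition eigenvalue_multiplicity :: "real mat \<Rightarrow> real \<Rightarrow> nat" where
  "eigenvalue_multiplicity A x = count (eigenvalue_multiset A) x"

text \<open>
  The \<open>k\<close>-th largest eigenvalue, counting from \<open>1\<close>; it is meaningful for
  \<open>1 \<le> k \<le> size (eigenvalue_multiset A)\<close> only.
\<close>

definition kth_eigenvalue :: "nat \<Rightarrow> real mat \<Rightarrow> real" where
  "kth_eigenvalue k A = rev (sorted_list_of_multiset (eigenvalue_multiset A)) ! (k - 1)"

end

theory Submission
  imports
    Defs
    "Jordan_Normal_Form.Schur_Decomposition"
    "Jordan_Normal_Form.Spectral_Radius"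
begin

text \<open>
  Let \<open>A\<close> be the adjacency matrix and \<open>m\<close> the multiplicity of the eigenvalue \<open>2\<close>. Since the second
  eigenvalue is \<open>2\<close>, the quadratic form of \<open>A - 2\<close> is positive definite on no two-dimensional space
  (\<open>quadratic_form_le_second_eigenvalue\<close>); and since \<open>A\<close> is symmetric, the eigenspace of \<open>2\<close> has
  dimension \<open>m\<close>, so any set of fewer than \<open>m\<close> vertices is avoided by the support of some nonzero
  eigenfunction of \<open>2\<close> (\<open>eigenfunction_vanishing_on_small_set\<close>). Both rest on the spectral theorem.

  If some function supported on a vertex set \<open>S\<close> has positive form, then \<open>m\<close> is at most the size of the
  closed neighbourhood of \<open>S\<close> (\<open>multiplicity_le_card_closed_neighbourhood\<close>). For otherwise an eigenfunction of
  \<open>2\<close> avoids this neighbourhood; its absolute value has nonnegative form, does not interact with the function on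
  \<open>S\<close>, and by connectedness can be perturbed to have positive form, which yields a forbidden
  two-dimensional space.

  If some vertex has degree at least five, \<open>S\<close> is taken to be a star with five leaves. With all degrees at
  most \<open>14\<close> its closed neighbourhood has at most \<open>15 + 5 * 13 = 80\<close> vertices.

  If all degrees are at most four, a subgraph with few vertices and largest eigenvalue at least \<open>2\<close> bounds \<open>m\<close> just as
  well, because unless it is the whole graph one further vertex makes the form positive
  (\<open>multiplicity_le_of_subharmonic_weight\<close>). Triangles, 4-cycles and the two tripods with arms \<open>2, 2, 2\<close> and
  \<open>1, 3, 3\<close> give at most \<open>45\<close>. A graph without these is almost a path: every vertex lies on a longest
  path or next to it, and a path vertex at distance at least three from both ends has no neighbours besides its two
  path neighbours. An eigenfunction of \<open>2\<close> that vanishes on the closed neighbourhoods of the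
  first three and the last three path vertices therefore vanishes everywhere, so \<open>m \<le> 30\<close>.
\<close>

section \<open>Orthogonal diagonalization of real symmetric matrices\<close>

text \<open>
  The matrix has a complex eigenvector \<open>z\<close>. Moving the matrix from one side of the Hermitian product
  of \<open>z\<close> with itself to the other shows that the eigenvalue is its own conjugate, so it is a real
  root of the characteristic polynomial.
\<close>

lemma real_symmetric_has_real_eigenvector:
  fixes A :: "real mat"
  assumes A: "A \<in> carrier_mat n n" and sym: "transpose_mat A = A" and "n > 0"
  obtains e v where "v \<in> carrier_vec n" "v \<noteq> 0\<^sub>v n" "A *\<^sub>v v = e \<cdot>\<^sub>v v"
proof -
  define C where "C = map_mat complex_of_real A"
  have C: "C \<in> carrier_mat n n" using A unfolding C_def by auto
  have symC: "transpose_mat C = C"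
    unfolding C_def by (subst (2) sym[symmetric]) (auto intro!: eq_matI)
  obtain l where l: "eigenvalue C l"
    using spectrum_non_empty[OF C \<open>n > 0\<close>] by (auto simp: spectrum_def)
  then obtain z where z: "z \<in> carrier_vec n" "z \<noteq> 0\<^sub>v n" "C *\<^sub>v z = l \<cdot>\<^sub>v z"
    using C by (auto simp: eigenvalue_def eigenvector_def)
  have cz: "conjugate z \<in> carrier_vec n" using z by simp
  have Ccz: "C *\<^sub>v conjugate z = conjugate (C *\<^sub>v z)"
    using z(1) A unfolding C_def
    by (intro eq_vecI) (auto simp: scalar_prod_def mult_mat_vec_def)
  have "l * (z \<bullet> conjugate z) = (C *\<^sub>v z) \<bullet> conjugate z"
    using z by simp
  also have "\<dots> = z \<bullet> (C *\<^sub>v conjugate z)"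
    using transpose_vec_mult_scalar[OF C cz z(1)] symC by simp
  also have "\<dots> = cnj l * (z \<bullet> conjugate z)"
    unfolding Ccz z(3) using z by (simp add: conjugate_smult_vec)
  finally have "l = cnj l"
    using z by simp
  then obtain r where r: "l = complex_of_real r"
    by (metis Reals_cases Reals_cnj_iff)
  have "poly (char_poly C) l = 0"
    using l eigenvalue_root_char_poly[OF C] by simp
  then have "poly (char_poly A) r = 0"
    unfolding r C_def of_real_hom.char_poly_hom[OF A] by simp
  then show ?thesis
    using eigenvalue_root_char_poly[OF A] that A by (auto simp: eigenvalue_def eigenvector_def)
qed

text \<open>
  Gram-Schmidt, applied to a basis that starts with \<open>v\<close>, leaves \<open>v\<close> in front; normalizing the result
  gives the columns of an orthogonal matrix.
\<close>

lemma real_orthonormal_completion: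
  fixes v :: "real vec"
  assumes v: "v \<in> carrier_vec n" "v \<noteq> 0\<^sub>v n"
  obtains W c where "W \<in> carrier_mat n n" "transpose_mat W * W = 1\<^sub>m n"
    "col W 0 = c \<cdot>\<^sub>v v"
proof -
  interpret cof_vec_space n "TYPE(real)" .
  define b where "b = basis_completion v"
  define ws where "ws = gram_schmidt n b"
  note bc = basis_completion[OF v, folded b_def]
  have n: "n \<noteq> 0" using v by (auto simp: zero_vec_def)
  obtain vs where bv: "b = v # vs" using bc(6,7) n by (cases b) auto
  have ws: "set ws \<subseteq> carrier_vec n" "corthogonal ws" "length ws = n"
    using gram_schmidt_result[OF bc(2,4,5) refl, folded ws_def] bc(6) by auto
  have hdws: "hd ws = v"
    using gram_schmidt_hd[OF v(1), of vs, folded bv] unfolding ws_def .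
  have wsi: "ws ! i \<in> carrier_vec n" if "i < n" for i using ws that by auto
  have orth: "ws ! i \<bullet> ws ! j = 0 \<longleftrightarrow> i \<noteq> j" if "i < n" "j < n" for i j
    using corthogonalD[OF ws(2), of i j] that ws(3) by simp
  define c where "c i = 1 / sqrt (ws ! i \<bullet> ws ! i)" for i
  define W where "W = mat_of_cols n (map (\<lambda>i. c i \<cdot>\<^sub>v ws ! i) [0..<n])"
  have W: "W \<in> carrier_mat n n" unfolding W_def by auto
  have colW: "col W i = c i \<cdot>\<^sub>v ws ! i" if "i < n" for i
    unfolding W_def using that wsi[OF that] by (subst col_mat_of_cols) auto
  have "transpose_mat W * W = 1\<^sub>m n"
  proof (rule eq_matI)
    fix i j assume "i < dim_row (1\<^sub>m n :: real mat)" "j < dim_col (1\<^sub>m n :: real mat)"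
    then have ij: "i < n" "j < n" by auto
    have pos: "ws ! i \<bullet> ws ! i > 0"
      using orth[of i i] ij conjugate_square_ge_0_vec[of "ws ! i"] wsi[OF ij(1)]
      by (metis less_eq_real_def vec_conjugate_real)
    have "(transpose_mat W * W) $$ (i, j) = c i * c j * (ws ! i \<bullet> ws ! j)"
      using W ij colW wsi[OF ij(1)] wsi[OF ij(2)] by simp
    also have "\<dots> = (if i = j then 1 else 0)"
      using orth[OF ij] pos by (auto simp: c_def)
    finally show "(transpose_mat W * W) $$ (i, j) = 1\<^sub>m n $$ (i, j)" using ij by simp
  qed (use W in auto)
  moreover have "col W 0 = c 0 \<cdot>\<^sub>v v"
    using colW[of 0] n hdws ws(3) by (metis gr0I hd_conv_nth list.size(3))
  ultimately show ?thesis using that W by blast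
qed

text \<open>
  The form in which two successive orthogonal changes of basis are composed below; with \<open>A = 1\<close> it
  also says that a product of orthogonal matrices is orthogonal.
\<close>

lemma transpose_congruence_mult:
  fixes A W R :: "'b::comm_ring_1 mat"
  assumes [simp]: "A \<in> carrier_mat n n" "W \<in> carrier_mat n n" "R \<in> carrier_mat n n"
  shows "transpose_mat (W * R) * A * (W * R) = transpose_mat R * (transpose_mat W * A * W) * R"
proof -
  have [simp]: "transpose_mat W \<in> carrier_mat n n" "transpose_mat R \<in> carrier_mat n n"
    by simp_all
  show ?thesis
    by (simp add: transpose_mult[of _ n n _ n] assoc_mult_mat[of _ n n _ n _ n]
        mult_carrier_mat[of _ n n])
qed

text \<open>
  By induction on the size. Let \<open>W\<close> be orthogonal with an eigenvector as first column. The first column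
  of \<open>W\<^sup>T A W\<close> then vanishes below the diagonal, and by symmetry so does its first row right of the
  diagonal; the induction hypothesis diagonalizes the remaining block.
\<close>

theorem real_symmetric_orthogonally_diagonalizable:
  fixes A :: "real mat"
  assumes "A \<in> carrier_mat n n" and "transpose_mat A = A"
  shows "\<exists>P D. P \<in> carrier_mat n n \<and> D \<in> carrier_mat n n \<and> diagonal_mat D \<and>
    transpose_mat P * P = 1\<^sub>m n \<and> transpose_mat P * A * P = D"
  using assms
proof (induction n arbitrary: A)
  case 0
  then show ?case by (intro exI[of _ "1\<^sub>m 0"] exI[of _ A]) (auto simp: diagonal_mat_def)
next
  case (Suc n A)
  note A = Suc.prems(1) and sym = Suc.prems(2)
  obtain e v where v: "v \<in> carrier_vec (Suc n)" "v \<noteq> 0\<^sub>v (Suc n)" "A *\<^sub>v v = e \<cdot>\<^sub>v v"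
    using real_symmetric_has_real_eigenvector[OF A sym zero_less_Suc] by blast
  obtain W c where W: "W \<in> carrier_mat (Suc n) (Suc n)" "transpose_mat W * W = 1\<^sub>m (Suc n)"
    and W0: "col W 0 = c \<cdot>\<^sub>v v"
    using real_orthonormal_completion[OF v(1,2)] .
  let ?WT = "transpose_mat W"
  have WT: "?WT \<in> carrier_mat (Suc n) (Suc n)" using W by simp
  define A' where "A' = ?WT * A * W"
  have A': "A' \<in> carrier_mat (Suc n) (Suc n)" using A W by (auto simp: A'_def)
  have symA': "transpose_mat A' = A'"
    unfolding A'_def using A W WT
    by (simp add: transpose_mult[of _ "Suc n" "Suc n" _ "Suc n"] sym)
  have col0: "A' $$ (i, 0) = (if i = 0 then e else 0)" if "i < Suc n" for i
  proof -
    have "A' $$ (i, 0) = (?WT * (A * W)) $$ (i, 0)"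
      unfolding A'_def using A W WT by simp
    also have "\<dots> = col W i \<bullet> (A *\<^sub>v col W 0)"
      using A W that by (simp add: mult_mat_vec_def)
    also have "A *\<^sub>v col W 0 = e \<cdot>\<^sub>v col W 0"
      unfolding W0 using A v by (simp add: mult_mat_vec smult_smult_assoc mult.commute)
    also have "col W i \<bullet> (e \<cdot>\<^sub>v col W 0) = e * (?WT * W) $$ (i, 0)"
      using W(1) that by simp
    also have "?WT * W = 1\<^sub>m (Suc n)" by (rule W(2))
    finally show ?thesis using that by simp
  qed
  have row0: "A' $$ (0, i) = (if i = 0 then e else 0)" if "i < Suc n" for i
    using col0[OF that] arg_cong[OF symA', of "\<lambda>M. M $$ (i, 0)"] A' that by simp
  obtain A1 A2 A0 A3 where split: "split_block A' 1 1 = (A1, A2, A0, A3)"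
    by (cases "split_block A' 1 1") auto
  have blocks: "A1 \<in> carrier_mat 1 1" "A2 \<in> carrier_mat 1 n" "A0 \<in> carrier_mat n 1"
    "A3 \<in> carrier_mat n n" "A' = four_block_mat A1 A2 A0 A3"
    using split_block[OF split, of n n] A' by auto
  have A2: "A2 = 0\<^sub>m 1 n" and A0: "A0 = 0\<^sub>m n 1"
    using split A' row0 col0 unfolding split_block_def Let_def by auto
  have symA3: "transpose_mat A3 = A3"
  proof (rule eq_matI)
    fix i j assume "i < dim_row A3" "j < dim_col A3"
    then show "transpose_mat A3 $$ (i, j) = A3 $$ (i, j)"
      using arg_cong[OF symA', of "\<lambda>M. M $$ (Suc i, Suc j)"] blocks A' by simp
  qed (use blocks in auto)
  obtain P D where P: "P \<in> carrier_mat n n" and D: "D \<in> carrier_mat n n" "diagonal_mat D"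
    and PP: "transpose_mat P * P = 1\<^sub>m n" and PAP: "transpose_mat P * A3 * P = D"
    using Suc.IH[OF blocks(4) symA3] by blast
  let ?R = "four_block_mat (1\<^sub>m 1) (0\<^sub>m 1 n) (0\<^sub>m n 1) P"
  let ?E = "four_block_mat A1 (0\<^sub>m 1 n) (0\<^sub>m n 1) D"
  have R: "?R \<in> carrier_mat (Suc n) (Suc n)" and E: "?E \<in> carrier_mat (Suc n) (Suc n)"
    using P D blocks by auto
  have RT: "transpose_mat ?R = four_block_mat (1\<^sub>m 1) (0\<^sub>m 1 n) (0\<^sub>m n 1) (transpose_mat P)"
    using P by (subst transpose_four_block_mat) auto
  have RTc: "transpose_mat ?R \<in> carrier_mat (Suc n) (Suc n)"
    using P unfolding RT by auto
  have PTc: "transpose_mat P \<in> carrier_mat n n" using P by simp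
  have PTA: "transpose_mat P * A3 \<in> carrier_mat n n" using P blocks by simp
  have RR: "transpose_mat ?R * ?R = 1\<^sub>m (Suc n)"
    unfolding RT
    by (subst mult_four_block_mat[of _ 1 1 _ n _ n _ _ 1 _ n])
      (use P PTc in \<open>auto simp: PP\<close>)
  have "transpose_mat ?R * A' = four_block_mat A1 (0\<^sub>m 1 n) (0\<^sub>m n 1) (transpose_mat P * A3)"
    unfolding RT blocks(5) A2 A0
    by (subst mult_four_block_mat[of _ 1 1 _ n _ n _ _ 1 _ n]) (use P PTc blocks in auto)
  then have RAR: "transpose_mat ?R * A' * ?R = ?E"
    by (simp only:, subst mult_four_block_mat[of _ 1 1 _ n _ n _ _ 1 _ n])
      (use P PTA blocks D(1) in \<open>auto simp: PAP\<close>)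
  define R' where "R' = ?R"
  define E' where "E' = ?E"
  have 1: "transpose_mat (W * R') * (W * R') = 1\<^sub>m (Suc n)"
  proof -
    have WR: "transpose_mat (W * R') \<in> carrier_mat (Suc n) (Suc n)"
      using W(1) R by (simp add: R'_def)
    show ?thesis
      using transpose_congruence_mult[OF one_carrier_mat W(1) R]
      unfolding R'_def[symmetric] right_mult_one_mat[OF WR] right_mult_one_mat[OF WT] W(2)
        right_mult_one_mat[OF RTc[folded R'_def]] RR[folded R'_def] .
  qed
  have 2: "transpose_mat (W * R') * A * (W * R') = E'"
    using transpose_congruence_mult[OF A W(1) R] RAR by (simp only: A'_def R'_def E'_def)
  have 3: "diagonal_mat E'"
    unfolding diagonal_mat_def
  proof (intro allI impI)
    fix i j assume "i < dim_row E'" "j < dim_col E'" "i \<noteq> j"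
    then show "E' $$ (i, j) = 0"
      using D blocks(1) by (cases i; cases j) (auto simp: E'_def diagonal_mat_def)
  qed
  have "W * R' \<in> carrier_mat (Suc n) (Suc n)" using W(1) R by (simp add: R'_def)
  moreover have "E' \<in> carrier_mat (Suc n) (Suc n)" using E by (simp add: E'_def)
  ultimately show ?case using 1 2 3 by blast
qed


section \<open>Eigenfunctions and quadratic forms on a finite set\<close>

text \<open>
  Gaussian elimination: an unknown \<open>p\<close> with a nonzero coefficient in equation \<open>k\<close> is eliminated from
  the other equations together with that equation. The system is indexed by arbitrary finite sets, so
  that it applies to functions on vertices without choosing coordinates.
\<close>

lemma underdetermined_system_has_nontrivial_solution:
  fixes b :: "'i \<Rightarrow> 'k \<Rightarrow> 'f::field"
  assumes "finite N" "finite I" "card N < card I"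
  shows "\<exists>c. (\<exists>i\<in>I. c i \<noteq> 0) \<and> (\<forall>k\<in>N. (\<Sum>i\<in>I. c i * b i k) = 0)"
  using assms
proof (induction N arbitrary: I b rule: finite_induct)
  case empty
  then have "I \<noteq> {}" by auto
  then show ?case by (intro exI[of _ "\<lambda>_. 1"]) auto
next
  case (insert k N)
  show ?case
  proof (cases "\<forall>i\<in>I. b i k = 0")
    case True
    have "card N < card I" using insert by simp
    from insert.IH[OF \<open>finite I\<close> this, of b] True show ?thesis by auto
  next
    case False
    then obtain p where p: "p \<in> I" "b p k \<noteq> 0" by auto
    define b' where "b' i l = b i l - b i k / b p k * b p l" for i l
    have "card N < card (I - {p})" using insert p by simp
    from insert.IH[OF _ this, of b'] \<open>finite I\<close> obtain c where
      c: "\<exists>i\<in>I - {p}. c i \<noteq> 0" "\<And>l. l \<in> N \<Longrightarrow> (\<Sum>i\<in>I - {p}. c i * b' i l) = 0"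
      by auto
    define c' where "c' = c(p := - (\<Sum>i\<in>I - {p}. c i * b i k) / b p k)"
    have sum: "(\<Sum>i\<in>I. c' i * b i l) = (\<Sum>i\<in>I - {p}. c i * b' i l)" for l
    proof -
      have "(\<Sum>i\<in>I. c' i * b i l) = c' p * b p l + (\<Sum>i\<in>I - {p}. c' i * b i l)"
        using p \<open>finite I\<close> by (simp add: sum.remove)
      also have "(\<Sum>i\<in>I - {p}. c' i * b i l) = (\<Sum>i\<in>I - {p}. c i * b i l)"
        by (intro sum.cong) (auto simp: c'_def)
      also have "c' p * b p l = - (\<Sum>i\<in>I - {p}. c i * (b i k / b p k * b p l))"
        by (simp add: c'_def sum_divide_distrib sum_distrib_right mult.assoc)
      finally show ?thesis by (simp add: b'_def right_diff_distrib sum_subtractf)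
    qed
    have "b' i k = 0" for i using p by (simp add: b'_def)
    then have "\<forall>l\<in>insert k N. (\<Sum>i\<in>I. c' i * b i l) = 0"
      using c(2) by (auto simp: sum)
    moreover have "\<exists>i\<in>I. c' i \<noteq> 0" using c(1) by (auto simp: c'_def)
    ultimately show ?thesis by blast
  qed
qed

lemma proots_prod_linear_factors:
  fixes xs :: "'a::idom list"
  shows "proots (\<Prod>x\<leftarrow>xs. [:- x, 1:]) = mset xs"
proof (induction xs)
  case (Cons x xs)
  have "(\<Prod>x\<leftarrow>xs. [:- x, 1:]) \<noteq> 0" by (auto simp: prod_list_zero_iff)
  then have "proots ([:- x, 1:] * (\<Prod>x\<leftarrow>xs. [:- x, 1:]))
    = proots [:- x, 1:] + proots (\<Prod>x\<leftarrow>xs. [:- x, 1:])"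
    by (intro proots_mult) auto
  then show ?case using Cons.IH by simp
qed simp

text \<open>
  The spectral theorem in terms of functions on the set that \<open>vs\<close> enumerates. The second property, the
  completeness of the system, is the orthogonality of the rows of the diagonalizing matrix; it gives the
  expansion of an arbitrary function.
\<close>

lemma orthonormal_eigenfunctions:
  fixes a :: "'a \<Rightarrow> 'a \<Rightarrow> real"
  assumes "distinct vs" and sym: "\<And>u v. a u v = a v u"
  defines "n \<equiv> length vs"
  defines "A \<equiv> mat n n (\<lambda>(i, j). a (vs ! i) (vs ! j))"
  obtains u :: "nat \<Rightarrow> 'a \<Rightarrow> real" and d :: "nat \<Rightarrow> real" where
    "\<And>i j. i < n \<Longrightarrow> j < n \<Longrightarrow> (\<Sum>v\<in>set vs. u i v * u j v) = (if i = j then 1 else 0)"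
    "\<And>v w. v \<in> set vs \<Longrightarrow> w \<in> set vs \<Longrightarrow> (\<Sum>i<n. u i v * u i w) = (if v = w then 1 else 0)"
    "\<And>i v. i < n \<Longrightarrow> v \<in> set vs \<Longrightarrow> (\<Sum>w\<in>set vs. a v w * u i w) = d i * u i v"
    "eigenvalue_multiset A = image_mset d (mset_set {..<n})"
proof -
  have A: "A \<in> carrier_mat n n" by (simp add: A_def)
  have "transpose_mat A = A" unfolding A_def by (rule eq_matI) (auto simp: sym)
  from real_symmetric_orthogonally_diagonalizable[OF A this]
  obtain P D where P: "P \<in> carrier_mat n n" and D: "D \<in> carrier_mat n n" "diagonal_mat D"
    and PP: "transpose_mat P * P = 1\<^sub>m n" and PAP: "transpose_mat P * A * P = D" by blast
  let ?PT = "transpose_mat P"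
  have PT: "?PT \<in> carrier_mat n n" using P by simp
  have PP': "P * ?PT = 1\<^sub>m n" by (rule mat_mult_left_right_inverse[OF PT P PP])
  have "P * D = (P * ?PT) * A * P"
    unfolding PAP[symmetric] using P PT A
    by (simp add: assoc_mult_mat[of _ n n _ n _ n] mult_carrier_mat[of _ n n])
  then have AP: "A * P = P * D" using PP' A by simp
  define d where "d i = D $$ (i, i)" for i
  define idx where "idx = the_inv_into {..<n} ((!) vs)"
  define u where "u i v = P $$ (idx v, i)" for i v
  have bij: "bij_betw ((!) vs) {..<n} (set vs)"
    using bij_betw_nth[OF \<open>distinct vs\<close>] by (simp add: n_def)
  have idx: "idx (vs ! k) = k" if "k < n" for k
    unfolding idx_def using bij that by (intro the_inv_into_f_f) (auto simp: bij_betw_def)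
  have sum_vs: "(\<Sum>v\<in>set vs. f v) = (\<Sum>k<n. f (vs ! k))" for f :: "'a \<Rightarrow> real"
    using sum.reindex_bij_betw[OF bij, of f] by simp
  have ex_idx: "\<exists>k<n. v = vs ! k" if "v \<in> set vs" for v
    using that by (auto simp: in_set_conv_nth n_def)
  have 1: "(\<Sum>v\<in>set vs. u i v * u j v) = (if i = j then 1 else 0)" if "i < n" "j < n" for i j
  proof -
    have "(\<Sum>v\<in>set vs. u i v * u j v) = (?PT * P) $$ (i, j)"
      using that P by (simp add: sum_vs u_def idx scalar_prod_def lessThan_atLeast0)
    then show ?thesis using that by (simp add: PP)
  qed
  have 2: "(\<Sum>i<n. u i v * u i w) = (if v = w then 1 else 0)" if vw: "v \<in> set vs" "w \<in> set vs" for v w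
  proof -
    obtain k l where kl: "k < n" "l < n" "v = vs ! k" "w = vs ! l" using vw ex_idx by blast
    have "(\<Sum>i<n. u i v * u i w) = (P * ?PT) $$ (k, l)"
      using kl P by (simp add: u_def idx scalar_prod_def lessThan_atLeast0)
    then show ?thesis using kl \<open>distinct vs\<close> by (simp add: PP' n_def nth_eq_iff_index_eq)
  qed
  have 3: "(\<Sum>w\<in>set vs. a v w * u i w) = d i * u i v" if iv: "i < n" "v \<in> set vs" for i v
  proof -
    obtain k where k: "k < n" "v = vs ! k" using iv ex_idx by blast
    have "(\<Sum>w\<in>set vs. a v w * u i w) = (A * P) $$ (k, i)"
      using k iv P by (simp add: A_def sum_vs u_def idx scalar_prod_def lessThan_atLeast0)
    also have "\<dots> = (\<Sum>j<n. P $$ (k, j) * D $$ (j, i))"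
      unfolding AP using k iv P D by (simp add: scalar_prod_def lessThan_atLeast0)
    also have "\<dots> = (\<Sum>j<n. if j = i then P $$ (k, i) * d i else 0)"
      using D iv by (intro sum.cong) (auto simp: diagonal_mat_def d_def)
    finally show ?thesis using iv k by (simp add: u_def idx)
  qed
  have "similar_mat_wit D A ?PT P"
    by (rule similar_mat_witI[of _ _ n]) (use P PT PP PP' PAP A D in auto)
  then have "char_poly A = char_poly D"
    using char_poly_similar unfolding similar_mat_def by metis
  also have "\<dots> = (\<Prod>x\<leftarrow>diag_mat D. [:- x, 1:])"
    using D by (intro char_poly_upper_triangular) (auto simp: diagonal_mat_def)
  finally have "eigenvalue_multiset A = proots (\<Prod>x\<leftarrow>diag_mat D. [:- x, 1:])"
    unfolding eigenvalue_multiset_def by simp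
  also have "\<dots> = mset (diag_mat D)"
    by (rule proots_prod_linear_factors)
  also have "diag_mat D = map d [0..<n]"
    using D by (auto simp: diag_mat_def d_def)
  also have "mset (map d [0..<n]) = image_mset d (mset_set {..<n})"
    by (simp add: mset_upt lessThan_atLeast0)
  finally have 4: "eigenvalue_multiset A = image_mset d (mset_set {..<n})" .
  show ?thesis by (rule that[of u d]) (rule 1 2 3 4; assumption)+
qed

lemma card_eigenvalues_above_second_le_1:
  fixes n :: nat and d :: "nat \<Rightarrow> real"
  assumes M: "eigenvalue_multiset A = image_mset d (mset_set {..<n})" and "2 \<le> n"
  shows "card {i. i < n \<and> d i > kth_eigenvalue 2 A} \<le> 1"
proof -
  define M where "M = eigenvalue_multiset A"
  define x where "x = kth_eigenvalue 2 A"
  define xs where "xs = rev (sorted_list_of_multiset M)"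
  have mset: "mset xs = M" by (simp add: xs_def)
  have len: "length xs = n" using arg_cong[OF mset, of size] M by (simp add: M_def)
  then obtain p ys where xs: "xs = p # x # ys"
    using \<open>2 \<le> n\<close> unfolding x_def kth_eigenvalue_def M_def[symmetric] xs_def[symmetric]
    by (cases xs; cases "tl xs") auto
  have "sorted_wrt (\<ge>) xs"
    unfolding xs_def sorted_wrt_rev by simp
  then have "\<forall>y\<in>set ys. y \<le> x" unfolding xs by simp
  then have *: "filter (\<lambda>y. y > x) ys = []" by (auto simp: filter_empty_conv)
  have "card {i. i < n \<and> d i > x} = size (filter_mset (\<lambda>y. y > x) M)"
    unfolding M_def M by (simp add: filter_mset_image_mset)
  also have "\<dots> = length (filter (\<lambda>y. y > x) xs)"
    unfolding mset[symmetric] by (metis mset_filter size_mset)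
  also have "\<dots> \<le> 1" unfolding xs using * by simp
  finally show ?thesis unfolding x_def .
qed

text \<open>
  One half of the Courant-Fischer principle. At most one of the eigenfunctions has an eigenvalue above the
  second one, and some nontrivial combination of \<open>f\<close> and \<open>g\<close> is orthogonal to it; on this combination
  the form is bounded by the second eigenvalue. A graph with second eigenvalue \<open>2\<close> therefore has no
  two-dimensional space of functions on which \<open>A - 2\<close> is positive definite.
\<close>

lemma quadratic_form_le_second_eigenvalue:
  fixes a :: "'a \<Rightarrow> 'a \<Rightarrow> real"
  assumes vs: "distinct vs" and sym: "\<And>u v. a u v = a v u" and n: "2 \<le> length vs"
  defines "A \<equiv> mat (length vs) (length vs) (\<lambda>(i, j). a (vs ! i) (vs ! j))"
  shows "\<exists>\<alpha> \<beta>. (\<alpha> \<noteq> 0 \<or> \<beta> \<noteq> 0) \<and>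
    (\<Sum>v\<in>set vs. (\<alpha> * f v + \<beta> * g v) * (\<Sum>w\<in>set vs. a v w * (\<alpha> * f w + \<beta> * g w)))
      \<le> kth_eigenvalue 2 A * (\<Sum>v\<in>set vs. (\<alpha> * f v + \<beta> * g v)\<^sup>2)"
proof -
  define n where "n = length vs"
  have A: "A = mat n n (\<lambda>(i, j). a (vs ! i) (vs ! j))" by (simp add: A_def n_def)
  define x where "x = kth_eigenvalue 2 A"
  obtain u d where ortho:
    "\<And>i j. i < n \<Longrightarrow> j < n \<Longrightarrow> (\<Sum>v\<in>set vs. u i v * u j v) = (if i = j then 1 else 0)"
    and complete:
    "\<And>v w. v \<in> set vs \<Longrightarrow> w \<in> set vs \<Longrightarrow> (\<Sum>i<n. u i v * u i w) = (if v = w then 1 else 0)"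
    and eigen:
    "\<And>i v. i < n \<Longrightarrow> v \<in> set vs \<Longrightarrow> (\<Sum>w\<in>set vs. a v w * u i w) = d i * u i v"
    and mult:
    "eigenvalue_multiset A = image_mset d (mset_set {..<n})"
    by (rule orthonormal_eigenfunctions[where a = a, OF vs sym, folded n_def], rule that)
      (assumption | simp only: A)+
  define J where "J = {i. i < n \<and> d i > x}"
  have J: "card J \<le> 1" "finite J"
    using card_eigenvalues_above_second_le_1[OF mult] n by (auto simp: J_def x_def n_def)
  define ip where "ip i h = (\<Sum>v\<in>set vs. u i v * h v)" for i h
  \<comment> \<open>The two coefficients are unknowns indexed by truth values; the at most one element of \<open>J\<close> is the only equation.\<close>
  have "\<exists>c. (\<exists>i\<in>UNIV. c i \<noteq> 0) \<and> (\<forall>j\<in>J. (\<Sum>i\<in>UNIV. c i * (if i then ip j f else ip j g)) = 0)"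
    using J by (intro underdetermined_system_has_nontrivial_solution) (auto simp: card_UNIV_bool)
  then obtain c where c: "\<exists>i. c i \<noteq> 0"
    "\<And>j. j \<in> J \<Longrightarrow> c True * ip j f + c False * ip j g = 0"
    by (auto simp: UNIV_bool add.commute)
  define h where "h v = c True * f v + c False * g v" for v
  have h0: "ip j h = 0" if "j \<in> J" for j
    using c(2)[OF that]
    by (simp add: ip_def h_def sum_distrib_left algebra_simps sum.distrib)
  have expand: "(\<Sum>i<n. ip i h * u i v) = h v" if "v \<in> set vs" for v
  proof -
    have "(\<Sum>i<n. ip i h * u i v) = (\<Sum>i<n. \<Sum>w\<in>set vs. h w * (u i w * u i v))"
      by (simp add: ip_def sum_distrib_left mult_ac)
    also have "\<dots> = (\<Sum>w\<in>set vs. h w * (\<Sum>i<n. u i w * u i v))"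
      by (subst sum.swap) (simp add: sum_distrib_left)
    also have "\<dots> = (\<Sum>w\<in>set vs. if w = v then h v else 0)"
      using complete that by (intro sum.cong) auto
    finally show ?thesis using that by simp
  qed
  have Ah: "(\<Sum>w\<in>set vs. a v w * h w) = (\<Sum>i<n. d i * ip i h * u i v)" if "v \<in> set vs" for v
  proof -
    have "(\<Sum>w\<in>set vs. a v w * h w) = (\<Sum>w\<in>set vs. \<Sum>i<n. ip i h * (a v w * u i w))"
      by (intro sum.cong refl, subst expand[symmetric]) (auto simp: sum_distrib_left mult_ac)
    also have "\<dots> = (\<Sum>i<n. ip i h * (\<Sum>w\<in>set vs. a v w * u i w))"
      by (subst sum.swap) (simp add: sum_distrib_left)
    finally show ?thesis using eigen that by (simp add: mult_ac)
  qed
  have "(\<Sum>v\<in>set vs. h v * (\<Sum>w\<in>set vs. a v w * h w)) = (\<Sum>v\<in>set vs. \<Sum>i<n. d i * ip i h * (u i v * h v))"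
    using Ah by (intro sum.cong) (auto simp: sum_distrib_left mult_ac)
  also have "\<dots> = (\<Sum>i<n. d i * ip i h * ip i h)"
    by (subst sum.swap) (simp only: sum_distrib_left[symmetric] ip_def[symmetric])
  also have "\<dots> = (\<Sum>i<n. d i * (ip i h)\<^sup>2)"
    by (simp add: power2_eq_square mult.assoc)
  also have "\<dots> \<le> (\<Sum>i<n. x * (ip i h)\<^sup>2)"
  proof (rule sum_mono)
    fix i assume "i \<in> {..<n}"
    then show "d i * (ip i h)\<^sup>2 \<le> x * (ip i h)\<^sup>2"
      using h0[of i] by (cases "d i > x") (auto simp: J_def mult_right_mono)
  qed
  also have "\<dots> = x * (\<Sum>v\<in>set vs. (\<Sum>i<n. ip i h * u i v) * h v)"
    unfolding sum_distrib_right
    by (subst sum.swap)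
       (simp add: sum_distrib_left[symmetric] ip_def[symmetric] power2_eq_square mult.assoc)
  also have "\<dots> = x * (\<Sum>v\<in>set vs. (h v)\<^sup>2)"
    using expand by (simp add: power2_eq_square)
  finally have "(\<Sum>v\<in>set vs. h v * (\<Sum>w\<in>set vs. a v w * h w)) \<le> x * (\<Sum>v\<in>set vs. (h v)\<^sup>2)" .
  moreover have "c True \<noteq> 0 \<or> c False \<noteq> 0"
    using c(1) by (simp add: ex_bool_eq)
  ultimately show ?thesis
    unfolding h_def x_def by (intro exI[of _ "c True"] exI[of _ "c False"] conjI)
qed

text \<open>
  The eigenspace has as many dimensions as the multiplicity says, so fewer linear conditions than that
  leave a nonzero eigenfunction. This is how every upper bound on the multiplicity below is obtained.
\<close>

lemma eigenfunction_vanishing_on_small_set: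
  fixes a :: "'a \<Rightarrow> 'a \<Rightarrow> real"
  assumes vs: "distinct vs" and sym: "\<And>u v. a u v = a v u"
  defines "A \<equiv> mat (length vs) (length vs) (\<lambda>(i, j). a (vs ! i) (vs ! j))"
  assumes N: "finite N" "card N < eigenvalue_multiplicity A x" "N \<subseteq> set vs"
  shows "\<exists>y. (\<exists>v\<in>set vs. y v \<noteq> 0) \<and> (\<forall>v\<in>set vs. (\<Sum>w\<in>set vs. a v w * y w) = x * y v) \<and>
    (\<forall>v\<in>N. y v = 0)"
proof -
  define n where "n = length vs"
  have A: "A = mat n n (\<lambda>(i, j). a (vs ! i) (vs ! j))" by (simp add: A_def n_def)
  obtain u d where ortho:
    "\<And>i j. i < n \<Longrightarrow> j < n \<Longrightarrow> (\<Sum>v\<in>set vs. u i v * u j v) = (if i = j then 1 else 0)"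
    and complete:
    "\<And>v w. v \<in> set vs \<Longrightarrow> w \<in> set vs \<Longrightarrow> (\<Sum>i<n. u i v * u i w) = (if v = w then 1 else 0)"
    and eigen:
    "\<And>i v. i < n \<Longrightarrow> v \<in> set vs \<Longrightarrow> (\<Sum>w\<in>set vs. a v w * u i w) = d i * u i v"
    and mult:
    "eigenvalue_multiset A = image_mset d (mset_set {..<n})"
    by (rule orthonormal_eigenfunctions[where a = a, OF vs sym, folded n_def], rule that)
      (assumption | simp only: A)+
  define I where "I = {i. i < n \<and> d i = x}"
  have "eigenvalue_multiplicity A x = size (filter_mset (\<lambda>y. y = x) (image_mset d (mset_set {..<n})))"
    unfolding eigenvalue_multiplicity_def mult filter_eq_replicate_mset by simp
  also have "\<dots> = card I"
    by (simp add: filter_mset_image_mset I_def)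
  finally have "card N < card I" using N by simp
  have fI: "finite I" by (simp add: I_def)
  from underdetermined_system_has_nontrivial_solution[OF N(1) fI \<open>card N < card I\<close>, of u]
  obtain c where c: "\<exists>i\<in>I. c i \<noteq> 0" "\<forall>v\<in>N. (\<Sum>i\<in>I. c i * u i v) = 0"
    by blast
  define y where "y v = (\<Sum>i\<in>I. c i * u i v)" for v
  have "(\<Sum>w\<in>set vs. a v w * y w) = x * y v" if "v \<in> set vs" for v
  proof -
    have "(\<Sum>w\<in>set vs. a v w * y w) = (\<Sum>w\<in>set vs. \<Sum>i\<in>I. c i * (a v w * u i w))"
      by (simp add: y_def sum_distrib_left mult_ac)
    also have "\<dots> = (\<Sum>i\<in>I. c i * (\<Sum>w\<in>set vs. a v w * u i w))"
      by (subst sum.swap) (simp add: sum_distrib_left)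
    also have "\<dots> = (\<Sum>i\<in>I. x * (c i * u i v))"
      using eigen that by (intro sum.cong) (auto simp: I_def)
    finally show ?thesis by (simp add: y_def sum_distrib_left)
  qed
  moreover have "\<exists>v\<in>set vs. y v \<noteq> 0"
  proof (rule ccontr)
    assume 0: "\<not> ?thesis"
    obtain j where j: "j \<in> I" "c j \<noteq> 0" using c by auto
    have "0 = (\<Sum>v\<in>set vs. y v * u j v)" using 0 by simp
    also have "\<dots> = (\<Sum>i\<in>I. c i * (\<Sum>v\<in>set vs. u i v * u j v))"
      unfolding y_def sum_distrib_right
      by (subst sum.swap) (simp add: sum_distrib_left mult_ac)
    also have "\<dots> = (\<Sum>i\<in>I. if i = j then c j else 0)"
      using ortho j by (intro sum.cong) (auto simp: I_def)
    finally show False using j fI by simp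
  qed
  ultimately show ?thesis using c(2)[folded y_def] by (intro exI[of _ y] conjI ballI) auto
qed


section \<open>The quadratic form of a graph and local bounds on the multiplicity\<close>

text \<open>
  From here on a graph is a set of vertices with an adjacency relation, which makes the neighbourhood of a
  vertex a plain set.
\<close>

locale finite_simple_graph =
  fixes V :: "'a set" and E :: "'a \<Rightarrow> 'a \<Rightarrow> bool"
  assumes finite_V: "finite V"
    and adj_in_V: "E u v \<Longrightarrow> u \<in> V"
    and adj_sym: "E u v \<Longrightarrow> E v u"
    and adj_irrefl: "\<not> E v v"
begin

definition nbs :: "'a \<Rightarrow> 'a set" where
  "nbs v = {w. E v w}"

text \<open>
  The bilinear form of \<open>A - 2\<close>, for \<open>A\<close> the adjacency matrix.
\<close>

definition form :: "('a \<Rightarrow> real) \<Rightarrow> ('a \<Rightarrow> real) \<Rightarrow> real" where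
  "form f g = (\<Sum>v\<in>V. f v * ((\<Sum>w\<in>nbs v. g w) - 2 * g v))"

lemma nbs_subset: "nbs v \<subseteq> V"
  using adj_in_V adj_sym by (auto simp: nbs_def)

lemma finite_nbs: "finite (nbs v)"
  using nbs_subset finite_V by (rule finite_subset)

lemma sum_nbs: "(\<Sum>w\<in>nbs v. f w) = (\<Sum>w\<in>V. if E v w then f w else (0::real))"
proof -
  have "nbs v = {w \<in> V. E v w}" using nbs_subset by (auto simp: nbs_def)
  then show ?thesis using finite_V by (simp add: sum.inter_filter)
qed

lemma form_commute: "form f g = form g f"
proof -
  have *: "form f g = (\<Sum>v\<in>V. \<Sum>w\<in>V. if E v w then f v * g w else 0) - 2 * (\<Sum>v\<in>V. f v * g v)" for f g
    unfolding form_def sum_nbs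
    by (simp add: right_diff_distrib sum_subtractf sum_distrib_left if_distrib mult_ac cong: if_cong)
  have "(\<Sum>v\<in>V. \<Sum>w\<in>V. if E v w then f v * g w else 0)
    = (\<Sum>w\<in>V. \<Sum>v\<in>V. if E v w then f v * g w else 0)" by (rule sum.swap)
  also have "\<dots> = (\<Sum>w\<in>V. \<Sum>v\<in>V. if E w v then g w * f v else 0)"
    using adj_sym by (intro sum.cong refl) (auto simp: mult_ac)
  finally show ?thesis unfolding * by (simp add: mult_ac)
qed

lemma form_lincomb_right: "form f (\<lambda>v. \<alpha> * g v + \<beta> * h v) = \<alpha> * form f g + \<beta> * form f h"
  unfolding form_def
  by (simp add: sum.distrib sum_subtractf sum_distrib_left algebra_simps)

lemma form_lincomb:
  "form (\<lambda>v. \<alpha> * f v + \<beta> * g v) (\<lambda>v. \<alpha> * f v + \<beta> * g v)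
    = \<alpha>\<^sup>2 * form f f + 2 * \<alpha> * \<beta> * form f g + \<beta>\<^sup>2 * form g g"
  (is "form ?h ?h = _")
proof -
  have "form ?h ?h = \<alpha> * form f ?h + \<beta> * form g ?h"
    by (subst form_commute, subst form_lincomb_right) (simp only: form_commute)
  then show ?thesis
    by (simp add: form_lincomb_right form_commute[of g f] power2_eq_square algebra_simps)
qed

lemma form_indicator_left:
  assumes "w \<in> V"
  shows "form (\<lambda>v. if v = w then 1 else 0) g = (\<Sum>u\<in>nbs w. g u) - 2 * g w"
proof -
  have "form (\<lambda>v. if v = w then 1 else 0) g
    = (\<Sum>v\<in>V. if v = w then (\<Sum>u\<in>nbs w. g u) - 2 * g w else 0)"
    unfolding form_def by (intro sum.cong) auto
  then show ?thesis using assms finite_V by simp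
qed

lemma form_indicator_self:
  assumes "w \<in> V"
  shows "form (\<lambda>v. if v = w then 1 else 0) (\<lambda>v. if v = w then 1 else 0) = - 2"
proof -
  have "(\<Sum>u\<in>nbs w. if u = w then 1 else 0) = (0::real)"
    using adj_irrefl by (intro sum.neutral) (auto simp: nbs_def)
  then show ?thesis by (simp add: form_indicator_left[OF assms])
qed

lemma sum_le_sum_nbs:
  assumes "\<And>t. t \<in> T \<Longrightarrow> E v t" and "\<And>u. f u \<ge> (0::real)"
  shows "sum f T \<le> sum f (nbs v)"
  using assms finite_nbs by (intro sum_mono2) (auto simp: nbs_def)

end

text \<open>
  All that the combinatorial argument uses of a connected graph with second eigenvalue \<open>2\<close>. The parameter
  \<open>m\<close> stands for the multiplicity of \<open>2\<close>. The first assumption is connectedness, the second is that the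
  eigenspace of \<open>2\<close> has at least \<open>m\<close> dimensions, and the third that \<open>A - 2\<close> has no
  two-dimensional positive definite subspace.
\<close>

locale second_eigenvalue_two_graph = finite_simple_graph +
  fixes m :: nat
  assumes cut: "\<lbrakk>X \<subseteq> V; X \<noteq> {}; X \<noteq> V\<rbrakk> \<Longrightarrow> \<exists>u\<in>X. \<exists>v\<in>V - X. E u v"
    and eigenfunction: "\<lbrakk>N \<subseteq> V; card N < m\<rbrakk> \<Longrightarrow>
      \<exists>y :: 'a \<Rightarrow> real. (\<exists>v\<in>V. y v \<noteq> 0) \<and> (\<forall>v\<in>V. (\<Sum>w\<in>nbs v. y w) = 2 * y v) \<and> (\<forall>v\<in>N. y v = 0)"
    and form_nonpos: "\<exists>\<alpha> \<beta>. (\<alpha> \<noteq> 0 \<or> \<beta> \<noteq> 0) \<and>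
      form (\<lambda>v. \<alpha> * f v + \<beta> * g v) (\<lambda>v. \<alpha> * f v + \<beta> * g v) \<le> 0"
begin

text \<open>
  The sets \<open>F\<close> allowed here are those on which an eigenfunction of \<open>2\<close> is determined by its values, such
  as the zero forcing sets of the graph.
\<close>

lemma multiplicity_le_card_forcing_set:
  assumes "F \<subseteq> V"
    and "\<And>(y :: 'a \<Rightarrow> real) v. \<lbrakk>\<And>v. v \<in> V \<Longrightarrow> (\<Sum>w\<in>nbs v. y w) = 2 * y v; \<And>v. v \<in> F \<Longrightarrow> y v = 0; v \<in> V\<rbrakk>
      \<Longrightarrow> y v = 0"
  shows "m \<le> card F"
proof (rule ccontr)
  assume "\<not> ?thesis"
  then have "card F < m" by simp
  from eigenfunction[OF assms(1) this] obtain y :: "'a \<Rightarrow> real" and v where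
    y: "\<forall>v\<in>V. (\<Sum>w\<in>nbs v. y w) = 2 * y v" "\<forall>v\<in>F. y v = 0" and v: "v \<in> V" "y v \<noteq> 0"
    by blast
  have "y v = 0" by (rule assms(2)[OF _ _ v(1)]) (use y in blast)+
  then show False using v(2) by simp
qed

text \<open>
  The central lemma. Let \<open>x\<close> live on \<open>S\<close> and have positive form, and suppose that the closed neighbourhood
  \<open>N\<close> of \<open>S\<close> had fewer than \<open>m\<close> vertices. Then some nonzero eigenfunction \<open>y\<close> of \<open>2\<close> vanishes on
  \<open>N\<close>. Its absolute value \<open>z\<close> has nonnegative form and is orthogonal to \<open>x\<close> for the form. By connectedness
  some vertex \<open>w\<close> with \<open>z w = 0\<close> is adjacent to one where \<open>z\<close> is positive. Adding a small multiple
  \<open>\<epsilon>\<close> of the indicator of \<open>w\<close> to \<open>z\<close> raises the form by a term linear in \<open>\<epsilon>\<close>, while the product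
  with \<open>x\<close> becomes only \<open>\<epsilon> b\<close>, whose square is of second order. For small \<open>\<epsilon>\<close> the form is thus
  positive definite on the span of \<open>x\<close> and the perturbed function, which is impossible.
\<close>

lemma multiplicity_le_card_closed_neighbourhood:
  assumes "S \<subseteq> V" and supp: "\<And>v. v \<notin> S \<Longrightarrow> x v = 0" and pos: "form x x > 0"
  shows "m \<le> card (\<Union>s\<in>S. insert s (nbs s))"
proof (rule ccontr)
  define N where "N = (\<Union>s\<in>S. insert s (nbs s))"
  assume "\<not> ?thesis"
  then have small: "card N < m" by (simp add: N_def)
  have NV: "N \<subseteq> V" using \<open>S \<subseteq> V\<close> nbs_subset by (auto simp: N_def)
  from eigenfunction[OF NV small] obtain y :: "'a \<Rightarrow> real" where y: "\<exists>v\<in>V. y v \<noteq> 0"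
    "\<And>v. v \<in> V \<Longrightarrow> (\<Sum>w\<in>nbs v. y w) = 2 * y v" "\<And>v. v \<in> N \<Longrightarrow> y v = 0"
    by blast
  define z where "z v = \<bar>y v\<bar>" for v
  define a where "a = form x x"
  define q where "q = form z z"
  have q: "q \<ge> 0"
    unfolding q_def form_def
  proof (intro sum_nonneg mult_nonneg_nonneg)
    fix v assume v: "v \<in> V"
    have "2 * z v = \<bar>\<Sum>w\<in>nbs v. y w\<bar>" using y(2)[OF v] by (simp add: z_def)
    also have "\<dots> \<le> (\<Sum>w\<in>nbs v. z w)" unfolding z_def by (rule sum_abs)
    finally show "0 \<le> (\<Sum>w\<in>nbs v. z w) - 2 * z v" by simp
  qed (simp add: z_def)
  have "S \<noteq> {}"
    using pos supp by (force simp: form_def)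
  then have "N \<noteq> {}" by (auto simp: N_def)
  define X where "X = {v \<in> V. z v \<noteq> 0}"
  have "X \<subseteq> V" "X \<noteq> {}" "X \<noteq> V"
    using y \<open>N \<noteq> {}\<close> NV by (auto simp: X_def z_def)
  then obtain c w where cw: "c \<in> X" "w \<in> V - X" "E c w" using cut by blast
  define e :: "'a \<Rightarrow> real" where "e = (\<lambda>v. if v = w then 1 else 0)"
  define p where "p = form e z"
  define b where "b = form x e"
  have "z w = 0" using cw by (simp add: X_def)
  then have "p = (\<Sum>u\<in>nbs w. z u)"
    using cw by (simp add: p_def e_def form_indicator_left)
  also have "\<dots> \<ge> z c"
    using cw(3)[THEN adj_sym] finite_nbs by (intro member_le_sum) (auto simp: nbs_def z_def)
  finally have "z c \<le> p" .
  moreover have "z c > 0" using cw by (simp add: X_def z_def)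
  ultimately have p: "p > 0" by linarith
  have ee: "form e e = - 2" using cw by (simp add: e_def form_indicator_self)
  have xz: "form x z = 0"
    unfolding form_def
  proof (intro sum.neutral ballI)
    fix v assume "v \<in> V"
    show "x v * ((\<Sum>w\<in>nbs v. z w) - 2 * z v) = 0"
    proof (cases "v \<in> S")
      case True
      then have "insert v (nbs v) \<subseteq> N" by (auto simp: N_def)
      then have "(\<Sum>w\<in>nbs v. z w) = 0" "z v = 0"
        using y(3) by (auto intro!: sum.neutral simp: z_def)
      then show ?thesis by simp
    qed (simp add: supp)
  qed
  \<comment> \<open>This choice makes the terms quadratic in \<open>\<epsilon>\<close> use up half of the linear gain in the determinant.\<close>
  define \<epsilon> where "\<epsilon> = a * p / (2 * a + b\<^sup>2)"
  define g where "g v = 1 * z v + \<epsilon> * e v" for v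
  define r where "r = form g g"
  have a: "a > 0" using pos by (simp add: a_def)
  then have D: "2 * a + b\<^sup>2 > 0" by (simp add: add_pos_nonneg)
  have \<epsilon>: "\<epsilon> > 0" using a p D by (simp add: \<epsilon>_def)
  have xg: "form x g = \<epsilon> * b"
    unfolding g_def form_lincomb_right by (simp add: xz b_def)
  have r: "r = q + 2 * \<epsilon> * p - 2 * \<epsilon>\<^sup>2"
    unfolding r_def g_def form_lincomb
    by (simp add: q_def p_def ee form_commute[of z e])
  have "a * r - (\<epsilon> * b)\<^sup>2 = a * q + 2 * a * \<epsilon> * p - \<epsilon> * (\<epsilon> * (2 * a + b\<^sup>2))"
    unfolding r by (simp add: power2_eq_square algebra_simps)
  also have "\<epsilon> * (2 * a + b\<^sup>2) = a * p" using D by (simp add: \<epsilon>_def)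
  finally have det: "a * r - (\<epsilon> * b)\<^sup>2 = a * q + a * \<epsilon> * p" by (simp add: algebra_simps)
  have "a * q + a * \<epsilon> * p > 0" using a q \<epsilon> p by (simp add: add_nonneg_pos)
  then have det_pos: "a * r - (\<epsilon> * b)\<^sup>2 > 0" by (simp add: det)
  obtain \<alpha> \<beta> where ab: "\<alpha> \<noteq> 0 \<or> \<beta> \<noteq> 0"
    "form (\<lambda>v. \<alpha> * x v + \<beta> * g v) (\<lambda>v. \<alpha> * x v + \<beta> * g v) \<le> 0"
    using form_nonpos by blast
  have le: "\<alpha>\<^sup>2 * a + 2 * \<alpha> * \<beta> * (\<epsilon> * b) + \<beta>\<^sup>2 * r \<le> 0"
    using ab(2) unfolding form_lincomb by (simp add: a_def r_def xg)
  \<comment> \<open>Completing the square.\<close>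
  have "(a * \<alpha> + \<beta> * (\<epsilon> * b))\<^sup>2 + \<beta>\<^sup>2 * (a * r - (\<epsilon> * b)\<^sup>2)
    = a * (\<alpha>\<^sup>2 * a + 2 * \<alpha> * \<beta> * (\<epsilon> * b) + \<beta>\<^sup>2 * r)"
    by (simp add: power2_eq_square algebra_simps)
  also have "\<dots> \<le> 0" using a le by (simp add: mult_nonneg_nonpos)
  finally have sq: "(a * \<alpha> + \<beta> * (\<epsilon> * b))\<^sup>2 + \<beta>\<^sup>2 * (a * r - (\<epsilon> * b)\<^sup>2) \<le> 0" .
  have "\<beta> = 0"
  proof (rule ccontr)
    assume "\<beta> \<noteq> 0"
    then have "\<beta>\<^sup>2 * (a * r - (\<epsilon> * b)\<^sup>2) > 0" using det_pos by simp
    then show False using sq by (smt (verit) zero_le_power2)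
  qed
  then show False using sq ab(1) a by simp
qed

text \<open>
  A positive weight on \<open>S\<close> with \<open>A x \<ge> 2 x\<close> there has nonnegative form. Unless \<open>S\<close> is everything, giving
  a small weight to one more vertex adjacent to \<open>S\<close> makes the form positive, as in the perturbation
  above, and the closed neighbourhood of \<open>S\<close> with this vertex has at most \<open>\<Delta> + 1\<close> vertices for each of its
  \<open>card S + 1\<close> members.
\<close>

lemma multiplicity_le_of_subharmonic_weight:
  fixes x :: "'a \<Rightarrow> real"
  assumes "S \<subseteq> V" "S \<noteq> {}"
    and pos: "\<And>v. v \<in> S \<Longrightarrow> x v > 0" and supp: "\<And>v. v \<notin> S \<Longrightarrow> x v = 0"
    and sub: "\<And>v. v \<in> S \<Longrightarrow> 2 * x v \<le> (\<Sum>w\<in>nbs v. x w)"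
    and deg: "\<And>v. v \<in> V \<Longrightarrow> card (nbs v) \<le> \<Delta>"
  shows "m \<le> Suc \<Delta> * Suc (card S)"
proof (cases "S = V")
  case True
  have "m \<le> card V"
    by (rule multiplicity_le_card_forcing_set) auto
  then show ?thesis unfolding True by simp
next
  case False
  have fS: "finite S" using \<open>S \<subseteq> V\<close> finite_V by (rule finite_subset)
  obtain c w where cw: "c \<in> S" "w \<in> V - S" "E c w"
    using cut[OF \<open>S \<subseteq> V\<close> \<open>S \<noteq> {}\<close> False] by blast
  have x0: "x v \<ge> 0" for v using pos[of v] supp[of v] by (cases "v \<in> S") auto
  have q: "form x x \<ge> 0"
    unfolding form_def
  proof (intro sum_nonneg)
    fix v show "x v * ((\<Sum>w\<in>nbs v. x w) - 2 * x v) \<ge> 0"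
      using sub[of v] x0[of v] supp[of v] by (cases "v \<in> S") auto
  qed
  define e :: "'a \<Rightarrow> real" where "e = (\<lambda>v. if v = w then 1 else 0)"
  define p where "p = form x e"
  have "p = (\<Sum>u\<in>nbs w. x u)"
    using cw supp[of w] by (simp add: p_def e_def form_commute[of x] form_indicator_left)
  also have "\<dots> \<ge> x c"
    using cw(3)[THEN adj_sym] finite_nbs x0 by (intro member_le_sum) (auto simp: nbs_def)
  finally have p: "p > 0" using pos[OF cw(1)] by simp
  have ee: "form e e = - 2" using cw by (simp add: e_def form_indicator_self)
  \<comment> \<open>The factor \<open>p / 2\<close> maximizes the gain \<open>2 \<epsilon> p - 2 \<epsilon>\<^sup>2\<close>.\<close>
  define f where "f v = 1 * x v + (p / 2) * e v" for v
  have "form f f = form x x + p\<^sup>2 / 2"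
    unfolding f_def form_lincomb using ee by (simp add: p_def power2_eq_square)
  then have "form f f > 0" using q p by (simp add: add_nonneg_pos)
  moreover have "f v = 0" if "v \<notin> insert w S" for v
    using that supp by (simp add: f_def e_def)
  ultimately have "m \<le> card (\<Union>s\<in>insert w S. insert s (nbs s))"
    using \<open>S \<subseteq> V\<close> cw by (intro multiplicity_le_card_closed_neighbourhood) auto
  also have "\<dots> \<le> (\<Sum>s\<in>insert w S. card (insert s (nbs s)))"
    using fS by (intro card_UN_le) simp
  also have "\<dots> \<le> (\<Sum>s\<in>insert w S. Suc \<Delta>)"
  proof (rule sum_mono)
    fix s assume "s \<in> insert w S"
    then have "s \<in> V" using \<open>S \<subseteq> V\<close> cw by auto
    then show "card (insert s (nbs s)) \<le> Suc \<Delta>"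
      using deg[of s] finite_nbs[of s] by (simp add: card_insert_if)
  qed
  also have "\<dots> = Suc \<Delta> * Suc (card S)" using fS cw by simp
  finally show ?thesis .
qed

text \<open>
  Constant weight; the cases of interest are short cycles.
\<close>

lemma multiplicity_le_of_min_degree_two:
  assumes "S \<subseteq> V" "S \<noteq> {}"
    and two: "\<And>v. v \<in> S \<Longrightarrow> \<exists>u w. u \<noteq> w \<and> {u, w} \<subseteq> S \<and> E v u \<and> E v w"
    and deg: "\<And>v. v \<in> V \<Longrightarrow> card (nbs v) \<le> \<Delta>"
  shows "m \<le> Suc \<Delta> * Suc (card S)"
proof (rule multiplicity_le_of_subharmonic_weight[OF assms(1,2) _ _ _ deg])
  fix v assume "v \<in> S"
  then obtain u w where "u \<noteq> w" "{u, w} \<subseteq> S" "E v u" "E v w" using two by blast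
  moreover from this have "(\<Sum>w\<in>{u, w}. if w \<in> S then 1 else (0::real)) \<le> (\<Sum>w\<in>nbs v. if w \<in> S then 1 else 0)"
    by (intro sum_le_sum_nbs) auto
  ultimately show "2 * (if v \<in> S then 1 else 0) \<le> (\<Sum>w\<in>nbs v. if w \<in> S then 1 else (0::real))"
    by auto
qed auto

lemma multiplicity_le_of_triangle:
  assumes "E a b" "E b c" "E c a" and deg: "\<And>v. v \<in> V \<Longrightarrow> card (nbs v) \<le> 4"
  shows "m \<le> 20"
proof -
  have neq: "a \<noteq> b" "b \<noteq> c" "c \<noteq> a" using assms(1-3) adj_irrefl by auto
  have two: "\<exists>u w. u \<noteq> w \<and> {u, w} \<subseteq> {a, b, c} \<and> E v u \<and> E v w" if v: "v \<in> {a, b, c}" for v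
  proof -
    from v consider "v = a" | "v = b" | "v = c" by blast
    then show ?thesis
    proof cases
      case 1
      then show ?thesis using assms(1-3) assms(1-3)[THEN adj_sym] neq
        by (intro exI[of _ c] exI[of _ b]) auto
    next
      case 2
      then show ?thesis using assms(1-3) assms(1-3)[THEN adj_sym] neq
        by (intro exI[of _ a] exI[of _ c]) auto
    next
      case 3
      then show ?thesis using assms(1-3) assms(1-3)[THEN adj_sym] neq
        by (intro exI[of _ b] exI[of _ a]) auto
    qed
  qed
  have "m \<le> Suc 4 * Suc (card {a, b, c})"
    by (rule multiplicity_le_of_min_degree_two[OF _ _ two deg]) (use assms(1-3)[THEN adj_in_V] in auto)
  then show ?thesis using neq assms(1-3) by simp
qed

lemma multiplicity_le_of_four_cycle:
  assumes "E a b" "E b c" "E c d" "E d a" "a \<noteq> c" "b \<noteq> d"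
    and deg: "\<And>v. v \<in> V \<Longrightarrow> card (nbs v) \<le> 4"
  shows "m \<le> 25"
proof -
  have neq: "a \<noteq> b" "b \<noteq> c" "c \<noteq> d" "d \<noteq> a" using assms(1-4) adj_irrefl by auto
  have two: "\<exists>u w. u \<noteq> w \<and> {u, w} \<subseteq> {a, b, c, d} \<and> E v u \<and> E v w" if v: "v \<in> {a, b, c, d}" for v
  proof -
    from v consider "v = a" | "v = b" | "v = c" | "v = d" by blast
    then show ?thesis
    proof cases
      case 1
      then show ?thesis using assms(1-4) assms(1-4)[THEN adj_sym] neq assms(5,6)
        by (intro exI[of _ d] exI[of _ b]) auto
    next
      case 2
      then show ?thesis using assms(1-4) assms(1-4)[THEN adj_sym] neq assms(5,6)
        by (intro exI[of _ a] exI[of _ c]) auto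
    next
      case 3
      then show ?thesis using assms(1-4) assms(1-4)[THEN adj_sym] neq assms(5,6)
        by (intro exI[of _ b] exI[of _ d]) auto
    next
      case 4
      then show ?thesis using assms(1-4) assms(1-4)[THEN adj_sym] neq assms(5,6)
        by (intro exI[of _ c] exI[of _ a]) auto
    qed
  qed
  have "m \<le> Suc 4 * Suc (card {a, b, c, d})"
    by (rule multiplicity_le_of_min_degree_two[OF _ _ two deg]) (use assms(1-4)[THEN adj_in_V] in auto)
  then show ?thesis using neq assms(1-6) by simp
qed

text \<open>
  The tripod with three arms of length two is the affine Dynkin diagram of type \<open>E\<^sub>6\<close>. Its index is \<open>2\<close>, and the
  weights are the entries of the null vector of its affine Cartan matrix. Further edges among the vertices
  only increase the sums over neighbours.
\<close>

lemma multiplicity_le_of_tripod_222: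
  assumes dist: "distinct [c, a1, a2, b1, b2, q1, q2]"
    and adj: "E c a1" "E a1 a2" "E c b1" "E b1 b2" "E c q1" "E q1 q2"
    and deg: "\<And>v. v \<in> V \<Longrightarrow> card (nbs v) \<le> 4"
  shows "m \<le> 40"
proof -
  define S where "S = {c, a1, a2, b1, b2, q1, q2}"
  define x :: "'a \<Rightarrow> real" where
    "x = (\<lambda>_. 0)(c := 3, a1 := 2, a2 := 1, b1 := 2, b2 := 1, q1 := 2, q2 := 1)"
  have x: "x c = 3" "x a1 = 2" "x a2 = 1" "x b1 = 2" "x b2 = 1" "x q1 = 2" "x q2 = 1"
    using dist by (auto simp: x_def)
  have x0: "x v \<ge> 0" for v by (simp add: x_def)
  note le = sum_le_sum_nbs[OF _ x0]
  have sub: "2 * x v \<le> (\<Sum>w\<in>nbs v. x w)" if v: "v \<in> S" for v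
  proof -
    have le_c: "sum x {a1, b1, q1} \<le> sum x (nbs c)" by (rule le) (use adj adj[THEN adj_sym] in auto)
    have le_a1: "sum x {c, a2} \<le> sum x (nbs a1)" by (rule le) (use adj adj[THEN adj_sym] in auto)
    have le_a2: "sum x {a1} \<le> sum x (nbs a2)" by (rule le) (use adj adj[THEN adj_sym] in auto)
    have le_b1: "sum x {c, b2} \<le> sum x (nbs b1)" by (rule le) (use adj adj[THEN adj_sym] in auto)
    have le_b2: "sum x {b1} \<le> sum x (nbs b2)" by (rule le) (use adj adj[THEN adj_sym] in auto)
    have le_q1: "sum x {c, q2} \<le> sum x (nbs q1)" by (rule le) (use adj adj[THEN adj_sym] in auto)
    have le_q2: "sum x {q1} \<le> sum x (nbs q2)" by (rule le) (use adj adj[THEN adj_sym] in auto)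
    from v consider "v = c" | "v = a1" | "v = a2" | "v = b1" | "v = b2" | "v = q1" | "v = q2" by (auto simp: S_def)
    then show ?thesis
    proof cases
      case 1 then show ?thesis using le_c dist by (simp add: x)
    next
      case 2 then show ?thesis using le_a1 dist by (simp add: x)
    next
      case 3 then show ?thesis using le_a2 dist by (simp add: x)
    next
      case 4 then show ?thesis using le_b1 dist by (simp add: x)
    next
      case 5 then show ?thesis using le_b2 dist by (simp add: x)
    next
      case 6 then show ?thesis using le_q1 dist by (simp add: x)
    next
      case 7 then show ?thesis using le_q2 dist by (simp add: x)
    qed
  qed
  have pos: "x v > 0" if "v \<in> S" for v using that x by (auto simp: S_def)
  have supp: "x v = 0" if "v \<notin> S" for v using that by (auto simp: S_def x_def)
  have "S \<subseteq> V" using adj[THEN adj_in_V] adj[THEN adj_sym, THEN adj_in_V] by (auto simp: S_def)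
  then have "m \<le> Suc 4 * Suc (card S)"
    by (rule multiplicity_le_of_subharmonic_weight[OF _ _ pos supp sub deg]) (auto simp: S_def)
  then show ?thesis using dist by (simp add: S_def)
qed

text \<open>
  The affine Dynkin diagram of type \<open>E\<^sub>7\<close>, with arms of length one, three and three, in the same role.
\<close>

lemma multiplicity_le_of_tripod_133:
  assumes dist: "distinct [c, q, a1, a2, a3, b1, b2, b3]"
    and adj: "E c q" "E c a1" "E a1 a2" "E a2 a3" "E c b1" "E b1 b2" "E b2 b3"
    and deg: "\<And>v. v \<in> V \<Longrightarrow> card (nbs v) \<le> 4"
  shows "m \<le> 45"
proof -
  define S where "S = {c, q, a1, a2, a3, b1, b2, b3}"
  define x :: "'a \<Rightarrow> real" where
    "x = (\<lambda>_. 0)(c := 4, q := 2, a1 := 3, a2 := 2, a3 := 1, b1 := 3, b2 := 2, b3 := 1)"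
  have x: "x c = 4" "x q = 2" "x a1 = 3" "x a2 = 2" "x a3 = 1" "x b1 = 3" "x b2 = 2" "x b3 = 1"
    using dist by (auto simp: x_def)
  have x0: "x v \<ge> 0" for v by (simp add: x_def)
  note le = sum_le_sum_nbs[OF _ x0]
  have sub: "2 * x v \<le> (\<Sum>w\<in>nbs v. x w)" if v: "v \<in> S" for v
  proof -
    have le_c: "sum x {q, a1, b1} \<le> sum x (nbs c)" by (rule le) (use adj adj[THEN adj_sym] in auto)
    have le_q: "sum x {c} \<le> sum x (nbs q)" by (rule le) (use adj adj[THEN adj_sym] in auto)
    have le_a1: "sum x {c, a2} \<le> sum x (nbs a1)" by (rule le) (use adj adj[THEN adj_sym] in auto)
    have le_a2: "sum x {a1, a3} \<le> sum x (nbs a2)" by (rule le) (use adj adj[THEN adj_sym] in auto)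
    have le_a3: "sum x {a2} \<le> sum x (nbs a3)" by (rule le) (use adj adj[THEN adj_sym] in auto)
    have le_b1: "sum x {c, b2} \<le> sum x (nbs b1)" by (rule le) (use adj adj[THEN adj_sym] in auto)
    have le_b2: "sum x {b1, b3} \<le> sum x (nbs b2)" by (rule le) (use adj adj[THEN adj_sym] in auto)
    have le_b3: "sum x {b2} \<le> sum x (nbs b3)" by (rule le) (use adj adj[THEN adj_sym] in auto)
    from v consider "v = c" | "v = q" | "v = a1" | "v = a2" | "v = a3" | "v = b1" | "v = b2" | "v = b3" by (auto simp: S_def)
    then show ?thesis
    proof cases
      case 1 then show ?thesis using le_c dist by (simp add: x)
    next
      case 2 then show ?thesis using le_q dist by (simp add: x)
    next
      case 3 then show ?thesis using le_a1 dist by (simp add: x)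
    next
      case 4 then show ?thesis using le_a2 dist by (simp add: x)
    next
      case 5 then show ?thesis using le_a3 dist by (simp add: x)
    next
      case 6 then show ?thesis using le_b1 dist by (simp add: x)
    next
      case 7 then show ?thesis using le_b2 dist by (simp add: x)
    next
      case 8 then show ?thesis using le_b3 dist by (simp add: x)
    qed
  qed
  have pos: "x v > 0" if "v \<in> S" for v using that x by (auto simp: S_def)
  have supp: "x v = 0" if "v \<notin> S" for v using that by (auto simp: S_def x_def)
  have "S \<subseteq> V" using adj[THEN adj_in_V] adj[THEN adj_sym, THEN adj_in_V] by (auto simp: S_def)
  then have "m \<le> Suc 4 * Suc (card S)"
    by (rule multiplicity_le_of_subharmonic_weight[OF _ _ pos supp sub deg]) (auto simp: S_def)
  then show ?thesis using dist by (simp add: S_def)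
qed

text \<open>
  A star with five leaves, with weight \<open>2\<close> at its centre and \<open>1\<close> at its leaves, has form at least
  \<open>2 * (5 - 4) + 5 * (2 - 2)\<close>, which is positive. Its closed neighbourhood has at most \<open>15\<close> vertices in the closed
  neighbourhood of the centre, and \<open>13\<close> more neighbours of each leaf; this is where \<open>80\<close> comes from.
\<close>

lemma multiplicity_le_of_large_degree:
  assumes c: "5 \<le> card (nbs c)" and deg: "\<And>v. v \<in> V \<Longrightarrow> card (nbs v) \<le> 14"
  shows "m \<le> 80"
proof -
  obtain L where L: "L \<subseteq> nbs c" "card L = 5" "finite L"
    using obtain_subset_with_card_n[OF c] .
  have adj: "E c l" if "l \<in> L" for l using L that by (auto simp: nbs_def)
  have "L \<noteq> {}" using L by auto
  then obtain l0 where "l0 \<in> L" by blast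
  then have cV: "c \<in> V" using adj adj_in_V by blast
  have cL: "c \<notin> L" using adj adj_irrefl by auto
  define x :: "'a \<Rightarrow> real" where "x v = (if v = c then 2 else if v \<in> L then 1 else 0)" for v
  have x0: "x v \<ge> 0" for v by (simp add: x_def)
  have "sum x L \<le> sum x (nbs c)" using adj x0 by (intro sum_le_sum_nbs) auto
  also have "sum x L = (\<Sum>l\<in>L. 1)" using cL by (intro sum.cong) (auto simp: x_def)
  finally have xc: "5 \<le> sum x (nbs c)" using L by simp
  have xl: "2 \<le> sum x (nbs l)" if "l \<in> L" for l
    using sum_le_sum_nbs[of "{c}" l x] adj[OF that, THEN adj_sym] x0 by (simp add: x_def)
  have "form x x \<ge> (\<Sum>v\<in>V. if v = c then 2 else 0)"
    unfolding form_def
  proof (rule sum_mono)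
    fix v assume "v \<in> V"
    show "(if v = c then 2 else 0) \<le> x v * (sum x (nbs v) - 2 * x v)"
      using xc xl[of v] by (auto simp: x_def[of v])
  qed
  then have pos: "form x x > 0" using cV finite_V by simp
  have LV: "L \<subseteq> V" using L nbs_subset by blast
  have "m \<le> card (\<Union>s\<in>insert c L. insert s (nbs s))"
    by (rule multiplicity_le_card_closed_neighbourhood[OF _ _ pos]) (use cV LV in \<open>auto simp: x_def\<close>)
  also have "(\<Union>s\<in>insert c L. insert s (nbs s)) \<subseteq> insert c (nbs c) \<union> (\<Union>l\<in>L. nbs l - {c})"
    using L by auto
  then have "card (\<Union>s\<in>insert c L. insert s (nbs s))
    \<le> card (insert c (nbs c) \<union> (\<Union>l\<in>L. nbs l - {c}))"
    using L finite_nbs by (intro card_mono) auto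
  also have "\<dots> \<le> card (insert c (nbs c)) + card (\<Union>l\<in>L. nbs l - {c})"
    by (rule card_Un_le)
  also have "\<dots> \<le> 15 + (\<Sum>l\<in>L. card (nbs l - {c}))"
    using deg[OF cV] finite_nbs card_UN_le[OF L(3), of "\<lambda>l. nbs l - {c}"]
    by (intro add_mono) (auto simp: card_insert_if)
  also have "(\<Sum>l\<in>L. card (nbs l - {c})) \<le> (\<Sum>l\<in>L. 13)"
  proof (rule sum_mono)
    fix l assume "l \<in> L"
    then have "c \<in> nbs l" "l \<in> V" using adj[THEN adj_sym] LV by (auto simp: nbs_def)
    then show "card (nbs l - {c}) \<le> 13" using deg[of l] finite_nbs by simp
  qed
  finally show ?thesis using L by simp
qed

end


section \<open>Longest paths in graphs of maximum degree four\<close>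

context finite_simple_graph
begin

definition is_path :: "'a list \<Rightarrow> bool" where
  "is_path ps \<longleftrightarrow> distinct ps \<and> set ps \<subseteq> V \<and> successively E ps"

definition longest_path :: "'a list \<Rightarrow> bool" where
  "longest_path ps \<longleftrightarrow> is_path ps \<and> (\<forall>qs. is_path qs \<longrightarrow> length qs \<le> length ps)"

lemma is_path_rev: "is_path ps \<Longrightarrow> is_path (rev ps)"
  by (auto simp: is_path_def intro: successively_mono adj_sym)

lemma longest_path_rev: "longest_path ps \<Longrightarrow> longest_path (rev ps)"
  by (simp add: longest_path_def is_path_rev)

lemma longest_path_exists:
  assumes "V \<noteq> {}"
  obtains ps where "longest_path ps" "ps \<noteq> []"
proof -
  obtain v where v: "is_path [v]" using assms by (auto simp: is_path_def)
  have "length ps < Suc (card V)" if "is_path ps" for ps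
    using that finite_V card_mono[of V "set ps"] by (simp add: is_path_def distinct_card)
  then obtain ps where ps: "is_path ps" "\<forall>qs. is_path qs \<longrightarrow> length qs \<le> length ps"
    using ex_has_greatest_nat[of is_path "[v]" length] v by blast
  then have "ps \<noteq> []" using v by fastforce
  then show ?thesis using that ps by (simp add: longest_path_def)
qed

lemma longest_path_first_closed:
  assumes ps: "longest_path ps" "ps \<noteq> []" and z: "E z (ps ! 0)"
  shows "z \<in> set ps"
proof (rule ccontr)
  assume "z \<notin> set ps"
  then have "is_path (z # ps)"
    using ps z adj_in_V[OF z]
    by (auto simp: longest_path_def is_path_def successively_Cons hd_conv_nth)
  then show False using ps by (fastforce simp: longest_path_def)
qed

text \<open>
  Replacing the first vertex by the detour \<open>w, u\<close> would lengthen the path.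
\<close>

lemma longest_path_no_detour_at_second:
  assumes ps: "longest_path ps" "1 < length ps"
    and w: "w \<notin> set ps" "u \<notin> set ps" "E w u" "E u (ps ! 1)"
  shows False
proof -
  obtain p qs where pq: "ps = p # qs" "qs \<noteq> []" using ps(2) by (cases ps) auto
  have "w \<noteq> u" using w(3) adj_irrefl by auto
  then have "is_path (w # u # qs)"
    using ps w adj_in_V[OF w(3)] adj_in_V[OF w(4)] pq
    by (auto simp: longest_path_def is_path_def successively_Cons hd_conv_nth)
  then show False using ps pq by (fastforce simp: longest_path_def)
qed

end

context second_eigenvalue_two_graph
begin

text \<open>
  A multiplicity above \<open>45\<close> excludes triangles, 4-cycles and both tripods at once.
\<close>

context
  assumes deg: "\<And>v. v \<in> V \<Longrightarrow> card (nbs v) \<le> 4" and big: "45 < m"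
begin

text \<open>
  With a third neighbour \<open>q\<close> the vertex would be the centre of a tripod whose other two arms are the three
  steps of the path in either direction, unless \<open>q\<close> is one of these path vertices; then it closes a triangle
  or a 4-cycle. Each of these configurations bounds the multiplicity by \<open>45\<close>.
\<close>

lemma path_inner_nbs:
  assumes ps: "is_path ps" and i: "3 \<le> i" "i + 3 < length ps"
  shows "nbs (ps ! i) = {ps ! (i - 1), ps ! (i + 1)}"
proof (rule ccontr)
  define p where "p k = ps ! k" for k
  have adj: "E (p k) (p (Suc k))" if "Suc k < length ps" for k
    using ps that by (simp add: p_def is_path_def successively_conv_nth)
  have inj: "p k = p l \<longleftrightarrow> k = l" if "k < length ps" "l < length ps" for k l
    using ps that by (simp add: p_def is_path_def nth_eq_iff_index_eq)
  obtain j where j: "i = j + 3" using i(1) by (metis add.commute le_Suc_ex)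
  have len: "j + 6 < length ps" using i j by simp
  have E: "E (p j) (p (j + 1))" "E (p (j + 1)) (p (j + 2))" "E (p (j + 2)) (p (j + 3))"
    "E (p (j + 3)) (p (j + 4))" "E (p (j + 4)) (p (j + 5))" "E (p (j + 5)) (p (j + 6))"
    using len adj[of j] adj[of "j + 1"] adj[of "j + 2"] adj[of "j + 3"] adj[of "j + 4"]
      adj[of "j + 5"] by (simp_all add: numeral_eq_Suc)
  note E' = E[THEN adj_sym]
  assume "\<not> ?thesis"
  moreover have "i - 1 = j + 2" "i + 1 = j + 4" using j by simp_all
  ultimately have "nbs (p (j + 3)) \<noteq> {p (j + 2), p (j + 4)}" by (simp only: j p_def simp_thms)
  moreover have "{p (j + 2), p (j + 4)} \<subseteq> nbs (p (j + 3))"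
    using E(4) E'(3) by (simp add: nbs_def)
  ultimately obtain q where q: "E (p (j + 3)) q" "q \<noteq> p (j + 2)" "q \<noteq> p (j + 4)"
    by (auto simp: nbs_def)
  note q' = q(1)[THEN adj_sym]
  have "q \<noteq> p (j + 3)" using q(1) adj_irrefl by auto
  have "q \<noteq> p (j + 1)"
    using multiplicity_le_of_triangle[OF E(2,3) _ deg] q(1) big by auto
  have "q \<noteq> p (j + 5)"
    using multiplicity_le_of_triangle[OF E(4,5) _ deg] q' big by auto
  have "q \<noteq> p j"
    using multiplicity_le_of_four_cycle[OF E(1,2,3) _ _ _ deg] q(1) big len by (auto simp: inj)
  have "q \<noteq> p (j + 6)"
    using multiplicity_le_of_four_cycle[OF E(4,5,6) _ _ _ deg] q' big len by (auto simp: inj)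
  have "distinct [p (j + 3), q, p (j + 2), p (j + 1), p j, p (j + 4), p (j + 5), p (j + 6)]"
    using q \<open>q \<noteq> p (j + 3)\<close> \<open>q \<noteq> p (j + 1)\<close> \<open>q \<noteq> p (j + 5)\<close> \<open>q \<noteq> p j\<close> \<open>q \<noteq> p (j + 6)\<close> len
    by (auto simp: inj)
  from multiplicity_le_of_tripod_133[OF this q(1) E'(3,2,1) E(4,5,6) deg] big
  show False by simp
qed

text \<open>
  Otherwise some edge leaves the closed neighbourhood of the path: it joins \<open>u\<close>, adjacent to the \<open>j\<close>-th vertex
  of the path, to a vertex \<open>w\<close> not adjacent to the path. Close to an end of the path this contradicts
  maximality, since \<open>u\<close> could be appended or \<open>w, u\<close> exchanged for the end vertex. Farther inside, \<open>u, w\<close>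
  and two steps of the path in either direction form a tripod with arms of length two.
\<close>

lemma longest_path_dominating:
  assumes ps: "longest_path ps" "ps \<noteq> []" and v: "v \<in> V" "v \<notin> set ps"
  shows "\<exists>i<length ps. E (ps ! i) v"
proof (rule ccontr)
  assume none: "\<not> ?thesis"
  define n where "n = length ps"
  define X where "X = set ps \<union> {w. \<exists>p\<in>set ps. E p w}"
  have psV: "set ps \<subseteq> V" and path: "is_path ps" using ps by (auto simp: longest_path_def is_path_def)
  have "X \<subseteq> V" using psV nbs_subset by (auto simp: X_def nbs_def)
  moreover have "X \<noteq> {}" using ps by (simp add: X_def)
  moreover have "X \<noteq> V" using none v by (auto simp: X_def in_set_conv_nth)
  ultimately obtain u w where uw: "u \<in> X" "w \<in> V - X" "E u w" using cut by blast
  have w: "w \<notin> set ps" "\<And>p. p \<in> set ps \<Longrightarrow> \<not> E p w" using uw by (auto simp: X_def)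
  then have u: "u \<notin> set ps" using uw by auto
  then obtain j where j: "j < n" "E (ps ! j) u" using uw by (auto simp: X_def n_def in_set_conv_nth)
  note sym = j(2)[THEN adj_sym] uw(3)[THEN adj_sym]
  have rev: "longest_path (rev ps)" "rev ps \<noteq> []" using ps longest_path_rev by auto
  have nth_rev: "rev ps ! k = ps ! (n - Suc k)" if "k < n" for k
    using that by (simp add: n_def rev_nth)
  have j0: "j \<noteq> 0"
    using longest_path_first_closed[OF ps, of u] sym(1) u by (intro notI) simp
  have j1: "j \<noteq> n - 1"
  proof
    assume "j = n - 1"
    then have "E u (rev ps ! 0)" using nth_rev[of 0] j(1) sym(1) by simp
    then show False using longest_path_first_closed[OF rev] u by simp
  qed
  have j2: "j \<noteq> 1"
    using longest_path_no_detour_at_second[OF ps(1) _ w(1) u sym(2)] sym(1) j(1)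
    by (intro notI) (simp add: n_def)
  have j3: "j \<noteq> n - 2"
  proof
    assume "j = n - 2"
    then have "1 < n" "rev ps ! 1 = ps ! j" using nth_rev[of 1] j(1) j0 by (simp_all add: numeral_2_eq_2)
    then show False
      using longest_path_no_detour_at_second[OF rev(1) _ _ _ sym(2)] sym(1) u w(1)
      by (simp add: n_def)
  qed
  define i where "i = j - 2"
  have i: "j = i + 2" and len: "i + 4 < n" using j(1) j0 j1 j2 j3 by (auto simp: i_def)
  have adj: "E (ps ! k) (ps ! Suc k)" if "Suc k < n" for k
    using path that by (simp add: n_def is_path_def successively_conv_nth)
  have E: "E (ps ! i) (ps ! (i + 1))" "E (ps ! (i + 1)) (ps ! (i + 2))"
    "E (ps ! (i + 2)) (ps ! (i + 3))" "E (ps ! (i + 3)) (ps ! (i + 4))"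
    using len adj[of i] adj[of "i + 1"] adj[of "i + 2"] adj[of "i + 3"]
    by (simp_all add: numeral_eq_Suc)
  have inj: "ps ! k = ps ! l \<longleftrightarrow> k = l" if "k < n" "l < n" for k l
    using path that by (simp add: n_def is_path_def nth_eq_iff_index_eq)
  have out: "ps ! k \<noteq> u" "ps ! k \<noteq> w" if "k < n" for k
    using u w(1) that by (auto simp: n_def)
  have "u \<noteq> w" using uw(3) adj_irrefl by auto
  then have "distinct [ps ! (i + 2), ps ! (i + 1), ps ! i, ps ! (i + 3), ps ! (i + 4), u, w]"
    using len by (simp add: inj out)
  from multiplicity_le_of_tripod_222[OF this E(2)[THEN adj_sym] E(1)[THEN adj_sym] E(3,4)
      j(2)[unfolded i] uw(3) deg] big
  show False by simp
qed

text \<open>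
  Inner vertices of the path have only their two path neighbours, so the eigenvalue equation propagates zeros
  along the path from its beginning; a vertex off the path can hang only on one of the three first or three
  last path vertices.
\<close>

lemma end_segments_force:
  assumes ps: "longest_path ps" "ps \<noteq> []"
    and y: "\<And>v. v \<in> V \<Longrightarrow> (\<Sum>w\<in>nbs v. y w) = 2 * (y v :: real)"
    and zero: "\<And>j v. j < length ps \<Longrightarrow> j < 3 \<or> length ps \<le> j + 3 \<Longrightarrow>
      v \<in> insert (ps ! j) (nbs (ps ! j)) \<Longrightarrow> y v = 0"
    and v: "v \<in> V"
  shows "y v = 0"
proof -
  have path: "is_path ps" using ps by (simp add: longest_path_def)
  have adj: "E (ps ! k) (ps ! Suc k)" if "Suc k < length ps" for k
    using path that by (simp add: is_path_def successively_conv_nth)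
  have on_path: "y (ps ! i) = 0" if "i < length ps" for i
    using that
  proof (induction i rule: less_induct)
    case (less i)
    consider "i < 3 \<or> length ps \<le> i + 3" | "i = 3" | "4 \<le> i" "i + 3 < length ps" by linarith
    then show ?case
    proof cases
      case 1
      then show ?thesis using zero[of i "ps ! i"] less.prems by blast
    next
      case 2
      \<comment> \<open>The recursion needs a predecessor that is an inner vertex; the vertex with index \<open>3\<close> has none, but it is a neighbour of the end segment.\<close>
      have "ps ! i \<in> nbs (ps ! 2)" using adj[of 2] less.prems 2 by (simp add: nbs_def)
      then show ?thesis using zero[of 2 "ps ! i"] less.prems 2 by simp
    next
      case 3
      \<comment> \<open>The equation at the predecessor \<open>k\<close> involves only \<open>k - 1\<close>, \<open>k\<close> and \<open>k + 1\<close>.\<close>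
      define k where "k = i - 1"
      have k: "i = k + 1" "3 \<le> k" "k + 3 < length ps" using 3 by (auto simp: k_def)
      have "ps ! k \<in> V" "ps ! (k - 1) \<noteq> ps ! (k + 1)"
        using path k by (auto simp: is_path_def nth_eq_iff_index_eq)
      then have "y (ps ! (k - 1)) + y (ps ! (k + 1)) = 2 * y (ps ! k)"
        using y[of "ps ! k"] path_inner_nbs[OF path k(2,3)] by simp
      moreover have "y (ps ! (k - 1)) = 0" "y (ps ! k) = 0"
        using less.IH[of "k - 1"] less.IH[of k] k by auto
      ultimately show ?thesis using k by simp
    qed
  qed
  show ?thesis
  proof (cases "v \<in> set ps")
    case True
    then show ?thesis using on_path by (auto simp: in_set_conv_nth)
  next
    case False
    then obtain j where j: "j < length ps" "E (ps ! j) v"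
      using longest_path_dominating[OF ps v] by blast
    have "j < 3 \<or> length ps \<le> j + 3"
    proof (rule ccontr)
      assume "\<not> ?thesis"
      then have "v = ps ! (j - 1) \<or> v = ps ! (j + 1)" "j + 1 < length ps"
        using path_inner_nbs[OF path, of j] j(2) by (auto simp: nbs_def)
      then show False using False j(1) by auto
    qed
    then show ?thesis using zero[of j v] j by (simp add: nbs_def)
  qed
qed

text \<open>
  At most six closed neighbourhoods, of at most five vertices each, force the eigenfunction to vanish, so the
  multiplicity would be at most \<open>30\<close>.
\<close>

lemma degree_le_4_contradiction:
  assumes "V \<noteq> {}"
  shows False
proof -
  obtain ps where ps: "longest_path ps" "ps \<noteq> []" using longest_path_exists[OF assms] .
  define n where "n = length ps"
  define J where "J = {j. j < n \<and> (j < 3 \<or> n \<le> j + 3)}"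
  define F where "F = (\<Union>j\<in>J. insert (ps ! j) (nbs (ps ! j)))"
  have psV: "ps ! j \<in> V" if "j \<in> J" for j
    using ps(1) that by (auto simp: J_def n_def longest_path_def is_path_def)
  have "J \<subseteq> {0, 1, 2, n - 1, n - 2, n - 3}" by (auto simp: J_def)
  then have "card J \<le> card {0, 1, 2, n - 1, n - 2, n - 3}" by (intro card_mono) auto
  also have "\<dots> \<le> length [0, 1, 2, n - 1, n - 2, n - 3]"
    using card_length[of "[0, 1, 2, n - 1, n - 2, n - 3]"] by simp
  finally have J: "card J \<le> 6" by simp
  have "m \<le> card F"
  proof (rule multiplicity_le_card_forcing_set)
    show "F \<subseteq> V" using psV nbs_subset by (auto simp: F_def)
  next
    fix y :: "'a \<Rightarrow> real" and v
    assume y: "\<And>v. v \<in> V \<Longrightarrow> (\<Sum>w\<in>nbs v. y w) = 2 * y v" and F: "\<And>v. v \<in> F \<Longrightarrow> y v = 0"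
      and v: "v \<in> V"
    show "y v = 0"
    proof (rule end_segments_force[OF ps y _ v])
      fix j u
      assume "j < length ps" "j < 3 \<or> length ps \<le> j + 3" "u \<in> insert (ps ! j) (nbs (ps ! j))"
      then have "u \<in> F" by (auto simp: F_def J_def n_def)
      then show "y u = 0" by (rule F)
    qed
  qed
  also have "card F \<le> (\<Sum>j\<in>J. card (insert (ps ! j) (nbs (ps ! j))))"
    unfolding F_def by (intro card_UN_le) (simp add: J_def)
  also have "\<dots> \<le> (\<Sum>j\<in>J. 5)"
  proof (rule sum_mono)
    fix j assume "j \<in> J"
    then show "card (insert (ps ! j) (nbs (ps ! j))) \<le> 5"
      using deg[OF psV, of j] finite_nbs[of "ps ! j"] by (simp add: card_insert_if)
  qed
  also have "\<dots> \<le> 30" using J by simp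
  finally show False using big by simp
qed

end

lemma multiplicity_le_of_degree_le_4:
  assumes "V \<noteq> {}" "\<And>v. v \<in> V \<Longrightarrow> card (nbs v) \<le> 4"
  shows "m \<le> 45"
  using degree_le_4_contradiction[OF assms(2) _ assms(1)] not_le by blast

theorem multiplicity_le_80:
  assumes "V \<noteq> {}" and deg: "\<And>v. v \<in> V \<Longrightarrow> card (nbs v) \<le> 14"
  shows "m \<le> 80"
proof (cases "\<exists>c. 5 \<le> card (nbs c)")
  case True
  then show ?thesis using multiplicity_le_of_large_degree deg by blast
next
  case False
  have "card (nbs v) \<le> 4" for v
  proof -
    have "\<not> 5 \<le> card (nbs v)" using False by blast
    then show ?thesis by simp
  qed
  then show ?thesis using multiplicity_le_of_degree_le_4[OF \<open>V \<noteq> {}\<close>] by fastforce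
qed

end

section \<open>The multiplicity of the second eigenvalue two\<close>

theorem lemma4:
  fixes G :: "('a, 'b) pre_digraph" and vs :: "'a list"
  assumes "graph G"
    and "Digraph_Component.connected G"
    and "distinct vs" and "set vs = verts G"
    and "2 \<le> card (verts G)"
    and "kth_eigenvalue 2 (adjacency_matrix G vs) = 2"
    and "max_degree G \<le> 14"
  shows "eigenvalue_multiplicity (adjacency_matrix G vs) 2 \<le> 80"
proof -
  interpret graph G by fact
  define V where "V = verts G"
  define E where "E u v \<longleftrightarrow> u \<rightarrow>\<^bsub>G\<^esub> v" for u v
  define A where "A = adjacency_matrix G vs"
  define a :: "'a \<Rightarrow> 'a \<Rightarrow> real" where "a u v = (if E u v then 1 else 0)" for u v
  have Esym: "E v u" if "E u v" for u v
    using that sym_arcs by (auto simp: E_def symmetric_def dest: symD)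
  have EV: "u \<in> V" if "E u v" for u v
    using that by (auto simp: E_def V_def arcs_ends_conv)
  interpret H: finite_simple_graph V E
  proof
    show "\<not> E v v" for v using no_loops by (auto simp: E_def arcs_ends_conv)
  qed (use Esym EV in \<open>auto simp: V_def\<close>)
  have vs: "distinct vs" "set vs = V" using assms by (auto simp: V_def)
  have asym: "a u v = a v u" for u v using Esym by (auto simp: a_def)
  have A: "A = mat (length vs) (length vs) (\<lambda>(i, j). a (vs ! i) (vs ! j))"
    by (simp add: A_def adjacency_matrix_def a_def E_def)
  have sum_a: "(\<Sum>w\<in>V. a v w * f w) = (\<Sum>w\<in>H.nbs v. f w)" for f v
    unfolding H.sum_nbs by (intro sum.cong) (auto simp: a_def)
  have len: "2 \<le> length vs" using assms distinct_card[OF vs(1)] by simp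
  interpret H: second_eigenvalue_two_graph V E "eigenvalue_multiplicity A 2"
  proof
    fix X assume X: "X \<subseteq> V" "X \<noteq> {}" "X \<noteq> V"
    show "\<exists>u\<in>X. \<exists>v\<in>V - X. E u v"
    proof (rule ccontr)
      assume closed: "\<not> ?thesis"
      have conn: "strongly_connected G"
        using symmetric_connected_imp_strongly_connected[OF sym_arcs assms(2)] .
      obtain u v where uv: "u \<in> X" "v \<in> V - X" using X by blast
      then have "u \<rightarrow>\<^sup>*\<^bsub>G\<^esub> v" using conn X by (auto simp: strongly_connected_def V_def)
      then have "v \<in> X"
      proof (induction rule: reachable_induct)
        case base
        show ?case by (rule uv(1))
      next
        case (step x y)
        then have "E x y" by (simp add: E_def)
        then show ?case using closed step EV[OF Esym] by blast
      qed
      then show False using uv by blast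
    qed
  next
    fix N assume N: "N \<subseteq> V" "card N < eigenvalue_multiplicity A 2"
    show "\<exists>y :: 'a \<Rightarrow> real. (\<exists>v\<in>V. y v \<noteq> 0) \<and> (\<forall>v\<in>V. (\<Sum>w\<in>H.nbs v. y w) = 2 * y v) \<and> (\<forall>v\<in>N. y v = 0)"
      using eigenfunction_vanishing_on_small_set[where a = a, OF vs(1) asym, where N = N and x = 2,
          folded A, unfolded vs(2) sum_a, OF finite_subset[OF N(1) H.finite_V] N(2,1)] .
  next
    fix f g :: "'a \<Rightarrow> real"
    have form_eq: "H.form h h = (\<Sum>v\<in>V. h v * (\<Sum>w\<in>H.nbs v. h w)) - 2 * (\<Sum>v\<in>V. (h v)\<^sup>2)" for h
      unfolding H.form_def
      by (simp add: sum_subtractf sum_distrib_left power2_eq_square right_diff_distrib mult.left_commute)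
    show "\<exists>\<alpha> \<beta>. (\<alpha> \<noteq> 0 \<or> \<beta> \<noteq> 0) \<and>
      H.form (\<lambda>v. \<alpha> * f v + \<beta> * g v) (\<lambda>v. \<alpha> * f v + \<beta> * g v) \<le> 0"
      unfolding form_eq diff_le_0_iff_le
      by (rule quadratic_form_le_second_eigenvalue[where a = a, OF vs(1) asym len,
            where f = f and g = g, folded A, unfolded vs(2) sum_a assms(6)[folded A_def]])
  qed
  have "card (H.nbs v) \<le> 14" if "v \<in> V" for v
  proof -
    have "H.nbs v = head G ` out_arcs G v"
      by (auto simp: H.nbs_def E_def arcs_ends_conv)
    then have "card (H.nbs v) \<le> out_degree G v"
      by (simp only: out_degree_def card_image_le[OF finite_out_arcs])
    also have "\<dots> \<le> max_degree G"
      using that by (auto simp: max_degree_def V_def)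
    finally show ?thesis using assms(7) by simp
  qed
  moreover have "V \<noteq> {}" using assms(5) by (auto simp: V_def)
  ultimately show ?thesis using H.multiplicity_le_80 by (simp add: A_def)
qed

end
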